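(* Let $X=\{x_1,\dots,x_n\}$ be a finite set and let $G$ be a subgroup of $\mathrm{Aut}(X)$ that acts transitively on $X$. Then for every linear group equivariant operator $F$ for $(\mathbb{R}^X,G)$ there exists a permutant measure $\mu$ with respect to $G$ such that $$F(\varphi)=\sum_{h\in \mathrm{Aut}(X)}\varphi h^{-1}\,\mu(h)\quad\text{for every }\varphi\in\mathbb{R}^X,$$ and $$\sum_{h\in\mathrm{Aut}(X)}|\mu(h)|=\max_{\varphi\in\mathbb{R}^X\setminus\{\mathbf{0}\}}\frac{\|F(\varphi)\|_\infty}{\|\varphi\|_\infty}.$$
   Context: $X$ is a finite (nonempty) set and $\mathbb{R}^X$ is the vector space of all functions $X\to\mathbb{R}$, with norm $\|\varphi\|_\infty=\max_{x\in X}|\varphi(x)|$. $\mathrm{Aut}(X)$ is the group of all permutations of $X$; it acts on $\mathbb{R}^X$ by composition on the right, and juxtaposition denotes composition of functions: $\varphi g=\varphi\circ g$, $h_1h_2=h_1\circ h_2$. For a subgroup $G\subseteq\mathrm{Aut}(X)$, a group equivariant operator (GEO) for $(\mathbb{R}^X,G)$ is a function $F:\mathbb{R}^X\to\mathbb{R}^X$ such that $F(\varphi g)=F(\varphi)g$ for all $\varphi\in\mathbb{R}^X$ and $g\in G$. A permutant measure with respect to $G$ is a finite signed measure $\mu$ on $\mathrm{Aut}(X)$ for which every subset of $\mathrm{Aut}(X)$ is measurable and $\mu(H)=\mu(gHg^{-1})$ for every $H\subseteq\mathrm{Aut}(X)$ and every $g\in G$ (equivalently, $\mu(\{h\})=\mu(\{ghg^{-1}\})$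 for all $h\in\mathrm{Aut}(X)$, $g\in G$). One writes $\mu(h)$ for $\mu(\{h\})$. *)

theory Defs
  imports "HOL-Analysis.Analysis" "HOL-Algebra.Group_Action"
begin

text \<open>
  The finite set \<open>X\<close> is the universe of a type \<open>'x\<close> of class \<open>finite\<close> (hence nonempty), and the
  space of functions \<open>X \<rightarrow> \<real>\<close> is \<open>real ^ 'x\<close>.  As \<open>BijGroup\<close> works with functions
  that are extensional on the given set, its elements over \<open>UNIV\<close> are all bijections of \<open>'x\<close>.
\<close>

abbreviation Aut :: "('x \<Rightarrow> 'x) monoid" where
  "Aut \<equiv> BijGroup UNIV"

lemma carrier_Aut: "carrier Aut = {h. bij h}"
  by (simp add: BijGroup_def Bij_def)

lemma mult_Aut: "bij g \<Longrightarrow> bij h \<Longrightarrow> g \<otimes>\<^bsub>Aut\<^esub> h = g \<circ> h"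
  by (simp add: BijGroup_def Bij_def compose_def comp_def restrict_def)

lemma infnorm_eq_Max: "infnorm (\<phi> :: real ^ 'x) = Max (range (\<lambda>x. \<bar>\<phi> $ x\<bar>))"
  by (simp add: infnorm_cart full_SetCompr_eq cSup_eq_Max)

definition rcomp :: "real ^ 'x \<Rightarrow> ('x \<Rightarrow> 'x) \<Rightarrow> real ^ 'x"  (infixl "\<diamondop>" 75) where
  "\<phi> \<diamondop> g = (\<chi> x. \<phi> $ g x)"

definition geo :: "('x \<Rightarrow> 'x) set \<Rightarrow> (real ^ 'x \<Rightarrow> real ^ 'x) \<Rightarrow> bool" where
  "geo G F \<longleftrightarrow> (\<forall>\<phi>. \<forall>g\<in>G. F (\<phi> \<diamondop> g) = F \<phi> \<diamondop> g)"

definition acts_transitively :: "('x \<Rightarrow> 'x) set \<Rightarrow> bool" where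
  "acts_transitively G \<longleftrightarrow> transitive_action (Aut\<lparr>carrier := G\<rparr>) UNIV (\<lambda>g. g)"

lemma acts_transitively_iff:
  assumes "subgroup G Aut"
  shows "acts_transitively G \<longleftrightarrow> (\<forall>x y. \<exists>g\<in>G. g x = y)"
proof -
  have "group_hom (Aut\<lparr>carrier := G\<rparr>) Aut (\<lambda>g. g)"
    using assms group_BijGroup[of UNIV]
    by (auto simp: group_hom_def group_hom_axioms_def hom_def
        intro: group.subgroup_imp_group dest: subgroup.mem_carrier)
  then show ?thesis
    by (simp add: acts_transitively_def transitive_action_def group_action_def
        transitive_action_axioms_def)
qed

text \<open>The values of \<open>\<mu>\<close> outside \<open>M\<close> are irrelevant.\<close>

definition finite_signed_measure :: "'a set \<Rightarrow> 'a set set \<Rightarrow> ('a set \<Rightarrow> real) \<Rightarrow> bool" where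
  "finite_signed_measure \<Omega> M \<mu> \<longleftrightarrow>
     sigma_algebra \<Omega> M \<and> \<mu> {} = 0 \<and>
     (\<forall>A :: nat \<Rightarrow> 'a set. range A \<subseteq> M \<longrightarrow> disjoint_family A \<longrightarrow>
        (\<lambda>i. \<mu> (A i)) sums \<mu> (\<Union>i. A i))"

text \<open>\<open>inv\<close> is notation of \<^theory>\<open>HOL-Algebra.Group\<close>, so the inverse function of a bijection is
  written \<^term>\<open>inv_into UNIV\<close>.\<close>

definition permutant_measure :: "('x \<Rightarrow> 'x) set \<Rightarrow> (('x \<Rightarrow> 'x) set \<Rightarrow> real) \<Rightarrow> bool" where
  "permutant_measure G \<mu> \<longleftrightarrow>
     finite_signed_measure (carrier Aut) (Pow (carrier Aut)) \<mu> \<and>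
     (\<forall>H \<subseteq> carrier Aut. \<forall>g\<in>G. \<mu> H = \<mu> ((\<lambda>h. g \<circ> h \<circ> inv_into UNIV g) ` H))"

text \<open>The maximum is asserted to exist; \<^term>\<open>Max\<close> is meaningful for finite sets only.\<close>

definition is_maximum :: "real \<Rightarrow> real set \<Rightarrow> bool" where
  "is_maximum m S \<longleftrightarrow> m \<in> S \<and> (\<forall>s\<in>S. s \<le> m)"

end

theory Submission
  imports Defs
begin

text \<open>
  Let \<open>B x y = F (axis y 1) $ x\<close> be the matrix of \<open>F\<close>.  A representation
  \<open>F \<phi> = (\<Sum>h. m h *\<^sub>R (\<phi> \<diamondop> inv_into UNIV h))\<close> says exactly that \<open>B x y\<close> is the sum of \<open>m h\<close> over the
  bijections \<open>h\<close> with \<open>h y = x\<close>, that is, \<open>B\<close> is a linear combination of permutation matrices.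
  For every such representation, the triangle inequality bounds the operator norm of \<open>F\<close> by
  \<open>\<Sum>h. \<bar>m h\<bar>\<close>.  The point is to find one in which no cancellation occurs, so that equality holds.

  Equivariance means that \<open>B (g x) (g y) = B x y\<close> for \<open>g \<in> G\<close>.  The positive and the
  negative part of \<open>B\<close> inherit this invariance, and by transitivity each part has all its row and column sums equal
  (\<open>transitive_invariant_sums\<close>).  By the Birkhoff--von Neumann theorem, each part is then a
  combination of permutation matrices with nonnegative coefficients whose total is the common row
  sum.  The difference of the two families of coefficients represents \<open>B\<close>, with total variation at
  most the sum of the two row sums, which is \<open>\<Sum>y. \<bar>B x y\<bar>\<close> for any row \<open>x\<close>
  (\<open>transitive_invariant_decomposition\<close>).

  These coefficients need not be invariant under conjugation by \<open>G\<close>.  Averaging them over \<open>G\<close>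
  makes them so; it keeps the represented matrix, because \<open>B\<close> is invariant, and it does not increase
  the total variation (\<open>average_over_conjugates\<close>).  Finally, the vector of signs of a row \<open>x\<close> has
  norm 1, and the entry \<open>x\<close> of its image is \<open>\<Sum>y. \<bar>B x y\<bar>\<close>.  So the norm of \<open>F\<close> is at least the total
  variation, and it is attained there.
\<close>

section \<open>Nonnegative matrices with constant row and column sums\<close>

text \<open>
  The proof of Halmos and Vaughan.  If every nonempty proper subfamily has more candidates than
  members, then one index can be served with any of its candidates without spoiling the condition
  for the others.  Otherwise some nonempty proper \<open>J\<close> has exactly as many candidates as members; it
  is served first, and since it uses up precisely the candidates in \<open>\<Union>(A ` J)\<close>, the condition for
  \<open>K \<union> J\<close> gives the condition for \<open>K\<close> with these candidates removed.
\<close>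

theorem hall_marriage:
  fixes A :: "'i \<Rightarrow> 'a set"
  assumes "finite I" and "\<And>i. i \<in> I \<Longrightarrow> finite (A i)"
    and "\<And>J. J \<subseteq> I \<Longrightarrow> card J \<le> card (\<Union>(A ` J))"
  shows "\<exists>f. inj_on f I \<and> (\<forall>i\<in>I. f i \<in> A i)"
  using assms
proof (induction I arbitrary: A rule: finite_psubset_induct)
  case (psubset I)
  note fin = psubset.prems(1) and hall = psubset.prems(2)
  show ?case
  proof (cases "I = {}")
    case True
    then show ?thesis by simp
  next
    case False
    then obtain i where i: "i \<in> I" by blast
    have finU: "finite (\<Union>(A ` J))" if "J \<subseteq> I" for J
      using finite_subset[OF that psubset.hyps(1)] fin that by (intro finite_UN_I) auto
    show ?thesis
    proof (cases "\<exists>J. J \<subset> I \<and> J \<noteq> {} \<and> card J = card (\<Union>(A ` J))")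
      case strict: False
      have "A i \<noteq> {}"
        using hall[of "{i}"] i by auto
      then obtain a where a: "a \<in> A i" by blast
      have "card J \<le> card (\<Union>((\<lambda>j. A j - {a}) ` J))" if J: "J \<subseteq> I - {i}" for J
      proof (cases "J = {}")
        case False
        have "J \<subset> I" using J i by blast
        then have "card J \<noteq> card (\<Union>(A ` J))" and "card J \<le> card (\<Union>(A ` J))"
          using strict False by (blast, intro hall) blast
        then have "card J < card (\<Union>(A ` J))"
          by linarith
        moreover have "(\<Union>j\<in>J. A j - {a}) = \<Union>(A ` J) - {a}" by blast
        ultimately show ?thesis
          by (auto simp: card_Diff_singleton_if)
      qed simp
      then have "\<exists>f. inj_on f (I - {i}) \<and> (\<forall>j\<in>I - {i}. f j \<in> A j - {a})"
        using i fin by (intro psubset.IH) auto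
      then obtain f where f: "inj_on f (I - {i})" "\<And>j. j \<in> I - {i} \<Longrightarrow> f j \<in> A j - {a}"
        by blast
      have "a \<notin> f ` (I - {i})"
        using f(2) by blast
      then have "inj_on (f(i := a)) (I - {i})" "a \<notin> (f(i := a)) ` (I - {i})"
        using f(1) by (auto intro: inj_on_fun_updI)
      then have "inj_on (f(i := a)) (insert i (I - {i}))"
        unfolding inj_on_insert by simp
      then have "inj_on (f(i := a)) I"
        using i by (simp only: insert_Diff)
      moreover have "\<forall>j\<in>I. (f(i := a)) j \<in> A j"
        using f(2) a by auto
      ultimately show ?thesis by blast
    next
      case True
      then obtain J where J: "J \<subset> I" "J \<noteq> {}" and tight: "card J = card (\<Union>(A ` J))"
        by blast
      let ?U = "\<Union>(A ` J)"
      have "\<exists>f. inj_on f J \<and> (\<forall>j\<in>J. f j \<in> A j)"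
        using J(1) fin hall by (intro psubset.IH) auto
      then obtain f1 where f1: "inj_on f1 J" "\<And>j. j \<in> J \<Longrightarrow> f1 j \<in> A j"
        by blast
      have "card K \<le> card (\<Union>((\<lambda>k. A k - ?U) ` K))" if K: "K \<subseteq> I - J" for K
      proof -
        have fK: "finite K" "finite J" "finite (\<Union>(A ` K))" "finite ?U"
          using K J psubset.hyps finU by (auto intro: finite_subset)
        have "card K + card J = card (K \<union> J)"
          using K fK by (intro card_Un_disjoint[symmetric]) auto
        also have "\<dots> \<le> card (\<Union>(A ` (K \<union> J)))"
          using hall[of "K \<union> J"] K J by blast
        also have "\<Union>(A ` (K \<union> J)) = (\<Union>k\<in>K. A k - ?U) \<union> ?U" by blast
        also have "card \<dots> \<le> card (\<Union>k\<in>K. A k - ?U) + card ?U"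
          by (rule card_Un_le)
        finally show ?thesis using tight by simp
      qed
      then have "\<exists>f. inj_on f (I - J) \<and> (\<forall>k\<in>I - J. f k \<in> A k - ?U)"
        using J fin by (intro psubset.IH) auto
      then obtain f2 where f2: "inj_on f2 (I - J)" "\<And>k. k \<in> I - J \<Longrightarrow> f2 k \<in> A k - ?U"
        by blast
      let ?f = "\<lambda>i. if i \<in> J then f1 i else f2 i"
      have "inj_on ?f I"
      proof (rule inj_onI)
        fix i j
        assume ij: "i \<in> I" "j \<in> I" and eq: "?f i = ?f j"
        have "f1 a \<in> ?U" if "a \<in> J" for a
          using f1(2) that by blast
        moreover have "f2 a \<notin> ?U" if "a \<in> I - J" for a
          using f2(2) that by blast
        ultimately have "i \<in> J \<longleftrightarrow> j \<in> J"
          using ij eq by (cases "i \<in> J"; cases "j \<in> J") force+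
        then consider "i \<in> J" "j \<in> J" | "i \<in> I - J" "j \<in> I - J"
          using ij by blast
        then show "i = j"
          using inj_onD[OF f1(1), of i j] inj_onD[OF f2(1), of i j] eq by cases auto
      qed
      moreover have "\<forall>i\<in>I. ?f i \<in> A i"
        using f1(2) f2(2) by auto
      ultimately show ?thesis by blast
    qed
  qed
qed

text \<open>
  Hall's condition holds for the supports of the columns: the columns in \<open>J\<close> carry the mass
  \<open>r * card J\<close>, all of it in the rows that meet their supports, and each row carries only \<open>r\<close>.
\<close>

lemma bij_in_support:
  fixes M :: "'x::finite \<Rightarrow> 'x \<Rightarrow> real"
  assumes nonneg: "\<And>x y. 0 \<le> M x y"
    and row: "\<And>x. (\<Sum>y\<in>UNIV. M x y) = r" and col: "\<And>y. (\<Sum>x\<in>UNIV. M x y) = r"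
    and "0 < r"
  shows "\<exists>h. bij h \<and> (\<forall>y. 0 < M (h y) y)"
proof -
  define A where "A y = {x. 0 < M x y}" for y
  have "card J \<le> card (\<Union>(A ` J))" for J
  proof -
    let ?U = "\<Union>(A ` J)"
    have "r * card J = (\<Sum>y\<in>J. \<Sum>x\<in>UNIV. M x y)"
      by (simp add: col)
    also have "\<dots> = (\<Sum>y\<in>J. \<Sum>x\<in>?U. M x y)"
      using nonneg
      by (intro sum.cong refl sum.mono_neutral_right) (auto simp: A_def order.order_iff_strict)
    also have "\<dots> = (\<Sum>x\<in>?U. \<Sum>y\<in>J. M x y)"
      by (rule sum.swap)
    also have "\<dots> \<le> (\<Sum>x\<in>?U. \<Sum>y\<in>UNIV. M x y)"
      using nonneg by (intro sum_mono sum_mono2) auto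
    also have "\<dots> = r * card ?U"
      by (simp add: row)
    finally show ?thesis using \<open>0 < r\<close> by simp
  qed
  then obtain h where "inj h" "\<forall>y. h y \<in> A y"
    using hall_marriage[of UNIV A] by auto
  then show ?thesis
    by (auto simp: A_def bij_def finite_UNIV_inj_surj)
qed

lemma bij_apply_eq_iff: "bij h \<Longrightarrow> h y = x \<longleftrightarrow> y = inv_into UNIV h x"
  using bij_inv_eq_iff by metis

text \<open>
  Subtracting as large a multiple as possible of a permutation matrix inside the support keeps the
  matrix nonnegative with constant row and column sums, and kills at least one entry, so the size
  of the support decreases.\<close>

theorem birkhoff_von_neumann:
  fixes M :: "'x::finite \<Rightarrow> 'x \<Rightarrow> real"
  assumes "\<And>x y. 0 \<le> M x y"
    and "\<And>x. (\<Sum>y\<in>UNIV. M x y) = r" and "\<And>y. (\<Sum>x\<in>UNIV. M x y) = r"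
  shows "\<exists>c. (\<forall>h. 0 \<le> c h) \<and> (\<forall>x y. M x y = (\<Sum>h | bij h. c h * of_bool (h y = x)))
           \<and> (\<Sum>h | bij h. c h) = r"
  using assms
proof (induction "card {(x, y). M x y \<noteq> 0}" arbitrary: M r rule: less_induct)
  case less
  note nonneg = less.prems(1) and row = less.prems(2) and col = less.prems(3)
  have "0 \<le> r"
    using row[of undefined, symmetric] nonneg by (simp add: sum_nonneg)
  show ?case
  proof (cases "r = 0")
    case True
    then have "M x y = 0" for x y
      using row[of x] nonneg by (simp add: sum_nonneg_eq_0_iff)
    then show ?thesis using True by (intro exI[of _ "\<lambda>_. 0"]) simp
  next
    case False
    then obtain h where h: "bij h" "\<And>y. 0 < M (h y) y"
      using bij_in_support[OF nonneg row col] \<open>0 \<le> r\<close> by fastforce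
    \<comment> \<open>the largest multiple of the permutation matrix of \<open>h\<close> below \<open>M\<close>\<close>
    define e where "e = Min (range (\<lambda>y. M (h y) y))"
    have "e \<in> range (\<lambda>y. M (h y) y)"
      unfolding e_def by (intro Min_in) auto
    then obtain y0 where y0: "e = M (h y0) y0" by blast
    have e_le: "e \<le> M (h y) y" for y
      unfolding e_def by (intro Min_le) auto
    have "0 < e" using y0 h by simp
    define N where "N x y = M x y - e * of_bool (h y = x)" for x y
    have "{(x, y). N x y \<noteq> 0} \<subset> {(x, y). M x y \<noteq> 0}"
    proof
      show "{(x, y). N x y \<noteq> 0} \<subseteq> {(x, y). M x y \<noteq> 0}"
        using h(2) by (auto simp: N_def) (metis less_irrefl)
      have "N (h y0) y0 = 0" "M (h y0) y0 \<noteq> 0"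
        using h(2)[of y0] y0 by (simp_all add: N_def)
      then show "{(x, y). N x y \<noteq> 0} \<noteq> {(x, y). M x y \<noteq> 0}" by blast
    qed
    then have "card {(x, y). N x y \<noteq> 0} < card {(x, y). M x y \<noteq> 0}"
      by (intro psubset_card_mono) auto
    moreover have "0 \<le> N x y" for x y
      using nonneg e_le by (auto simp: N_def)
    moreover have "(\<Sum>y\<in>UNIV. N x y) = r - e" for x
    proof -
      have "{y. h y = x} = {inv_into UNIV h x}"
        using bij_apply_eq_iff[OF h(1)] by simp
      then show ?thesis
        by (simp add: N_def sum_subtractf row flip: sum_distrib_left)
    qed
    moreover have "(\<Sum>x\<in>UNIV. N x y) = r - e" for y
      by (simp add: N_def sum_subtractf col flip: sum_distrib_left)
    ultimately obtain c where c: "\<And>k. 0 \<le> c k"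
        "\<And>x y. N x y = (\<Sum>k | bij k. c k * of_bool (k y = x))" "(\<Sum>k | bij k. c k) = r - e"
      using less.hyps[of N "r - e"] by blast
    define d where "d k = c k + e * of_bool (k = h)" for k
    have "M x y = (\<Sum>k | bij k. d k * of_bool (k y = x))" for x y
    proof -
      have "(\<Sum>k | bij k. d k * of_bool (k y = x))
          = N x y + (\<Sum>k | bij k. if k = h then e * of_bool (h y = x) else 0)"
        unfolding c(2) sum.distrib[symmetric] by (intro sum.cong) (auto simp: d_def)
      also have "\<dots> = M x y"
        using h(1) by (simp add: N_def)
      finally show ?thesis by simp
    qed
    moreover have "0 \<le> d k" for k
      using c(1) \<open>0 < e\<close> by (simp add: d_def)
    moreover have "(\<Sum>k | bij k. d k) = r"
    proof -
      have "(\<Sum>k | bij k. d k) = (\<Sum>k | bij k. c k) + (\<Sum>k | bij k. if k = h then e else 0)"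
        unfolding sum.distrib[symmetric] by (intro sum.cong) (auto simp: d_def)
      then show ?thesis using h(1) c(3) by simp
    qed
    ultimately show ?thesis by blast
  qed
qed

section \<open>Matrices invariant under a transitive group\<close>

text \<open>
  An element of \<open>G\<close> that moves \<open>x\<close> to \<open>z\<close> permutes row \<open>x\<close> onto row \<open>z\<close>, and similarly for columns.
  The matrix being square, the common row sum and the common column sum agree, by counting the sum
  of all entries in two ways.
\<close>

lemma transitive_invariant_sums:
  fixes M :: "'x::finite \<Rightarrow> 'x \<Rightarrow> real"
  assumes bij: "\<And>g. g \<in> G \<Longrightarrow> bij g"
    and trans: "\<And>x y. \<exists>g\<in>G. g x = y"
    and inv: "\<And>g x y. g \<in> G \<Longrightarrow> M (g x) (g y) = M x y"
  shows "\<exists>r. (\<forall>x. (\<Sum>y\<in>UNIV. M x y) = r) \<and> (\<forall>y. (\<Sum>x\<in>UNIV. M x y) = r)"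
proof -
  have row: "(\<Sum>y\<in>UNIV. M x y) = (\<Sum>y\<in>UNIV. M z y)" for x z
  proof -
    obtain g where g: "g \<in> G" "g x = z" using trans by blast
    have "(\<Sum>y\<in>UNIV. M z y) = (\<Sum>y\<in>UNIV. M z (g y))"
      by (rule sum.reindex_bij_betw[symmetric]) (use bij g in simp)
    then show ?thesis using inv[OF g(1), of x] g(2) by simp
  qed
  have col: "(\<Sum>x\<in>UNIV. M x y) = (\<Sum>x\<in>UNIV. M x z)" for y z
  proof -
    obtain g where g: "g \<in> G" "g y = z" using trans by blast
    have "(\<Sum>x\<in>UNIV. M x z) = (\<Sum>x\<in>UNIV. M (g x) z)"
      by (rule sum.reindex_bij_betw[symmetric]) (use bij g in simp)
    then show ?thesis using inv[OF g(1), of _ y] g(2) by simp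
  qed
  have "(\<Sum>y\<in>UNIV. M a y) = (\<Sum>x\<in>UNIV. M x b)" for a b
  proof -
    have "CARD('x) * (\<Sum>y\<in>UNIV. M a y) = (\<Sum>x\<in>UNIV. \<Sum>y\<in>UNIV. M x y)"
    proof -
      have "(\<Sum>x\<in>UNIV. \<Sum>y\<in>UNIV. M x y) = (\<Sum>x\<in>(UNIV :: 'x set). \<Sum>y\<in>UNIV. M a y)"
        by (intro sum.cong refl row)
      then show ?thesis by simp
    qed
    also have "\<dots> = (\<Sum>y\<in>UNIV. \<Sum>x\<in>UNIV. M x y)"
      by (rule sum.swap)
    also have "\<dots> = CARD('x) * (\<Sum>x\<in>UNIV. M x b)"
    proof -
      have "(\<Sum>y\<in>UNIV. \<Sum>x\<in>UNIV. M x y) = (\<Sum>y\<in>(UNIV :: 'x set). \<Sum>x\<in>UNIV. M x b)"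
        by (intro sum.cong refl col)
      then show ?thesis by simp
    qed
    finally show ?thesis by simp
  qed
  then have "(\<Sum>x\<in>UNIV. M x y) = (\<Sum>y\<in>UNIV. M undefined y)" for y
    by (rule sym)
  then show ?thesis
    by (intro exI[of _ "\<Sum>y\<in>UNIV. M undefined y"] conjI allI row)
qed

text \<open>
  Since the positive and the negative part of \<open>B\<close> are decomposed separately, the bound on
  \<open>\<Sum>h. \<bar>c h\<bar>\<close> is the sum of the two row sums.  It holds for every row, as these row sums are constant.
\<close>

lemma transitive_invariant_decomposition:
  fixes G :: "('x::finite \<Rightarrow> 'x) set" and B :: "'x \<Rightarrow> 'x \<Rightarrow> real"
  assumes bij: "\<And>g. g \<in> G \<Longrightarrow> bij g"
    and trans: "\<And>x y. \<exists>g\<in>G. g x = y"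
    and inv: "\<And>g x y. g \<in> G \<Longrightarrow> B (g x) (g y) = B x y"
  shows "\<exists>c. (\<forall>x y. B x y = (\<Sum>h | bij h. c h * of_bool (h y = x)))
           \<and> (\<forall>x. (\<Sum>h | bij h. \<bar>c h\<bar>) \<le> (\<Sum>y\<in>UNIV. \<bar>B x y\<bar>))"
proof -
  have part: "\<exists>c. (\<forall>h. 0 \<le> c h) \<and> (\<forall>x y. p (B x y) = (\<Sum>h | bij h. c h * of_bool (h y = x)))
      \<and> (\<forall>x. (\<Sum>h | bij h. c h) = (\<Sum>y\<in>UNIV. p (B x y)))"
    if "\<And>t. 0 \<le> p t" for p :: "real \<Rightarrow> real"
  proof -
    obtain r where r: "\<And>x. (\<Sum>y\<in>UNIV. p (B x y)) = r" "\<And>y. (\<Sum>x\<in>UNIV. p (B x y)) = r"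
      using transitive_invariant_sums[of G "\<lambda>x y. p (B x y)", OF bij trans] inv by auto
    show ?thesis
      using birkhoff_von_neumann[of "\<lambda>x y. p (B x y)" r] that r by simp
  qed
  obtain c where c: "\<And>h. 0 \<le> c h"
      "\<And>x y. max 0 (B x y) = (\<Sum>h | bij h. c h * of_bool (h y = x))"
      "\<And>x. (\<Sum>h | bij h. c h) = (\<Sum>y\<in>UNIV. max 0 (B x y))"
    using part[of "\<lambda>t. max 0 t"] by (force simp del: sum_mult_of_bool_eq)
  obtain d where d: "\<And>h. 0 \<le> d h"
      "\<And>x y. max 0 (- B x y) = (\<Sum>h | bij h. d h * of_bool (h y = x))"
      "\<And>x. (\<Sum>h | bij h. d h) = (\<Sum>y\<in>UNIV. max 0 (- B x y))"
    using part[of "\<lambda>t. max 0 (- t)"] by (force simp del: sum_mult_of_bool_eq)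
  have "B x y = (\<Sum>h | bij h. (c h - d h) * of_bool (h y = x))" for x y
  proof -
    have "B x y = max 0 (B x y) - max 0 (- B x y)" by simp
    then show ?thesis
      by (simp only: c(2) d(2) left_diff_distrib sum_subtractf)
  qed
  moreover have "(\<Sum>h | bij h. \<bar>c h - d h\<bar>) \<le> (\<Sum>y\<in>UNIV. \<bar>B x y\<bar>)" for x
  proof -
    have "\<bar>c h - d h\<bar> \<le> c h + d h" for h
      using c(1)[of h] d(1)[of h] by linarith
    then have "(\<Sum>h | bij h. \<bar>c h - d h\<bar>) \<le> (\<Sum>h | bij h. c h) + (\<Sum>h | bij h. d h)"
      by (simp add: sum_mono flip: sum.distrib)
    also have "\<dots> = (\<Sum>y\<in>UNIV. \<bar>B x y\<bar>)"
      unfolding c(3)[of x] d(3)[of x] sum.distrib[symmetric] by (intro sum.cong) auto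
    finally show ?thesis .
  qed
  ultimately show ?thesis by (intro exI[of _ "\<lambda>h. c h - d h"]) blast
qed

section \<open>Averaging over conjugates\<close>

lemma bij_betw_conjugation:
  fixes g :: "'x \<Rightarrow> 'x"
  assumes "bij g"
  shows "bij_betw (\<lambda>h. g \<circ> h \<circ> inv_into UNIV g) {h. bij h} {h. bij h}"
proof (rule bij_betw_byWitness[where f' = "\<lambda>h. inv_into UNIV g \<circ> h \<circ> g"])
  have inv: "bij (inv_into UNIV g)"
    using assms by (rule bij_imp_bij_inv)
  show "(\<lambda>h. g \<circ> h \<circ> inv_into UNIV g) ` {h. bij h} \<subseteq> {h. bij h}"
    and "(\<lambda>h. inv_into UNIV g \<circ> h \<circ> g) ` {h. bij h} \<subseteq> {h. bij h}"
    using assms inv by (simp_all add: image_subset_iff bij_comp)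
  have "inv_into UNIV g (g x) = x" "g (inv_into UNIV g x) = x" for x
    using assms by (simp_all add: bij_is_inj bij_is_surj surj_f_inv_f)
  then show "\<forall>h\<in>{h. bij h}. inv_into UNIV g \<circ> (g \<circ> h \<circ> inv_into UNIV g) \<circ> g = h"
    and "\<forall>h\<in>{h. bij h}. g \<circ> (inv_into UNIV g \<circ> h \<circ> g) \<circ> inv_into UNIV g = h"
    by (simp_all add: fun_eq_iff)
qed

text \<open>
  The mean of \<open>c\<close> over all conjugates by \<open>g \<in> G\<close> does not change if \<open>h\<close> is replaced by its conjugate
  by \<open>k \<in> G\<close>, since \<open>g \<circ> k\<close> runs through \<open>G\<close> as \<open>g\<close> does.
  The conjugate coefficients \<open>\<lambda>h. c (g \<circ> h \<circ> inv_into UNIV g)\<close> represent the matrix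
  \<open>\<lambda>x y. B (g x) (g y)\<close>, which is \<open>B\<close> again.  Hence so does their mean over \<open>g \<in> G\<close>.
\<close>

lemma average_over_conjugates:
  fixes G :: "('x::finite \<Rightarrow> 'x) set" and c :: "('x \<Rightarrow> 'x) \<Rightarrow> real"
  assumes bij: "\<And>g. g \<in> G \<Longrightarrow> bij g" and "G \<noteq> {}"
    and comp: "\<And>g k. g \<in> G \<Longrightarrow> k \<in> G \<Longrightarrow> g \<circ> k \<in> G"
    and inv: "\<And>g x y. g \<in> G \<Longrightarrow> B (g x) (g y) = B x y"
    and rep: "\<And>x y. B x y = (\<Sum>h | bij h. c h * of_bool (h y = x))"
  shows "\<exists>m. (\<forall>g\<in>G. \<forall>h. m (g \<circ> h \<circ> inv_into UNIV g) = m h)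
           \<and> (\<forall>x y. B x y = (\<Sum>h | bij h. m h * of_bool (h y = x)))
           \<and> (\<Sum>h | bij h. \<bar>m h\<bar>) \<le> (\<Sum>h | bij h. \<bar>c h\<bar>)"
proof (intro exI conjI ballI allI)
  let ?conj = "\<lambda>g h. g \<circ> h \<circ> inv_into UNIV g"
  let ?m = "\<lambda>h. (\<Sum>g\<in>G. c (?conj g h)) / card G"
  have G: "0 < card G"
    using \<open>G \<noteq> {}\<close> by (simp add: card_gt_0_iff)
  show "?m (?conj k h) = ?m h" if k: "k \<in> G" for k h
  proof -
    have inj: "inj_on (\<lambda>g. g \<circ> k) G"
      using bij_is_surj[OF bij[OF k]] by (auto simp: inj_on_def surj_fun_eq)
    moreover have "(\<lambda>g. g \<circ> k) ` G = G"
      using inj comp k by (intro endo_inj_surj) auto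
    ultimately have "bij_betw (\<lambda>g. g \<circ> k) G G"
      by (simp add: bij_betw_def)
    then have "(\<Sum>g\<in>G. c (?conj g h)) = (\<Sum>g\<in>G. c (?conj (g \<circ> k) h))"
      by (rule sum.reindex_bij_betw[symmetric])
    also have "\<dots> = (\<Sum>g\<in>G. c (?conj g (?conj k h)))"
      by (intro sum.cong refl arg_cong[where f = c]) (simp add: o_inv_distrib bij k o_assoc)
    finally show ?thesis by simp
  qed
  show "B x y = (\<Sum>h | bij h. ?m h * of_bool (h y = x))" for x y
  proof -
    have "(\<Sum>h | bij h. c (?conj g h) * of_bool (h y = x)) = B x y" if g: "g \<in> G" for g
    proof -
      have "inv_into UNIV g (g y) = y" for y
        using bij[OF g] by (simp add: bij_is_inj)
      then have eq: "h y = x \<longleftrightarrow> ?conj g h (g y) = g x" for h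
        using bij[OF g] by (simp add: bij_is_inj inj_eq)
      have "(\<Sum>h | bij h. c (?conj g h) * of_bool (h y = x))
          = (\<Sum>h | bij h. c (?conj g h) * of_bool (?conj g h (g y) = g x))"
        unfolding eq[symmetric] ..
      also have "\<dots> = (\<Sum>h | bij h. c h * of_bool (h (g y) = g x))"
        by (rule sum.reindex_bij_betw[OF bij_betw_conjugation[OF bij[OF g]],
              of "\<lambda>h. c h * of_bool (h (g y) = g x)"])
      also have "\<dots> = B (g x) (g y)"
        by (rule rep[symmetric])
      finally show ?thesis
        by (simp only: inv[OF g])
    qed
    then have "card G * B x y = (\<Sum>g\<in>G. \<Sum>h | bij h. c (?conj g h) * of_bool (h y = x))"
      by simp
    also have "\<dots> = (\<Sum>h | bij h. (\<Sum>g\<in>G. c (?conj g h)) * of_bool (h y = x))"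
      by (subst sum.swap) (simp only: sum_distrib_right)
    finally show ?thesis
      using \<open>G \<noteq> {}\<close> by (simp add: field_simps flip: sum_divide_distrib)
  qed
  have "(\<Sum>h | bij h. \<bar>?m h\<bar>) \<le> (\<Sum>h | bij h. (\<Sum>g\<in>G. \<bar>c (?conj g h)\<bar>) / card G)"
    using G by (intro sum_mono) (simp add: divide_right_mono)
  also have "\<dots> = (\<Sum>g\<in>G. \<Sum>h | bij h. \<bar>c (?conj g h)\<bar>) / card G"
    by (subst sum.swap) (simp add: sum_divide_distrib)
  also have "\<dots> = (\<Sum>g\<in>G. \<Sum>h | bij h. \<bar>c h\<bar>) / card G"
    by (intro arg_cong2[where f = "(/)"] sum.cong refl
        sum.reindex_bij_betw[OF bij_betw_conjugation[OF bij], of _ "\<lambda>h. \<bar>c h\<bar>"])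
  also have "\<dots> = (\<Sum>h | bij h. \<bar>c h\<bar>)"
    using \<open>G \<noteq> {}\<close> by simp
  finally show "(\<Sum>h | bij h. \<bar>?m h\<bar>) \<le> (\<Sum>h | bij h. \<bar>c h\<bar>)" .
qed

section \<open>From coefficients to permutant measures\<close>

text \<open>
  A sum over a set \<open>H \<subseteq> \<Omega>\<close> is a sum over \<open>\<Omega>\<close> with indicators of \<open>H\<close>, so countable additivity can be
  checked at a single point, where at most one term of the series is nonzero.
\<close>

lemma finite_signed_measure_sum:
  fixes m :: "'a \<Rightarrow> real"
  assumes "finite \<Omega>"
  shows "finite_signed_measure \<Omega> (Pow \<Omega>) (sum m)"
  unfolding finite_signed_measure_def
proof (intro conjI allI impI)
  fix A :: "nat \<Rightarrow> 'a set"
  assume A: "range A \<subseteq> Pow \<Omega>" and disj: "disjoint_family A"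
  have "(\<lambda>i. m h * of_bool (h \<in> A i)) sums (m h * of_bool (h \<in> (\<Union>i. A i)))" for h
  proof (cases "\<exists>i. h \<in> A i")
    case True
    then obtain i where "h \<in> A i" by blast
    moreover from this have "h \<in> A j \<longleftrightarrow> j = i" for j
      using disj by (auto simp: disjoint_family_on_def)
    ultimately show ?thesis
      using sums_single[of i "\<lambda>_. m h"] by (auto simp: of_bool_def if_distrib cong: if_cong)
  qed simp
  then have "(\<lambda>i. \<Sum>h\<in>\<Omega>. m h * of_bool (h \<in> A i))
      sums (\<Sum>h\<in>\<Omega>. m h * of_bool (h \<in> (\<Union>i. A i)))"
    by (intro sums_sum)
  moreover have "(\<Sum>h\<in>\<Omega>. m h * of_bool (h \<in> H)) = sum m H" if "H \<subseteq> \<Omega>" for H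
    using assms that by (simp add: of_bool_def if_distrib Int_absorb1 flip: sum.inter_restrict
      cong: if_cong)
  moreover have "A i \<subseteq> \<Omega>" "(\<Union>i. A i) \<subseteq> \<Omega>" for i
    using A by auto
  ultimately show "(\<lambda>i. sum m (A i)) sums sum m (\<Union>i. A i)"
    by (simp only:)
qed (simp_all add: sigma_algebra_Pow)

lemma permutant_measure_sum:
  fixes G :: "('x::finite \<Rightarrow> 'x) set"
  assumes bij: "\<And>g. g \<in> G \<Longrightarrow> bij g"
    and inv: "\<And>g h. g \<in> G \<Longrightarrow> m (g \<circ> h \<circ> inv_into UNIV g) = m h"
  shows "permutant_measure G (sum m)"
  unfolding permutant_measure_def
proof (intro conjI allI ballI impI)
  show "finite_signed_measure (carrier Aut) (Pow (carrier Aut)) (sum m)"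
    by (rule finite_signed_measure_sum) simp
  fix H :: "('x \<Rightarrow> 'x) set" and g
  assume "H \<subseteq> carrier Aut" and g: "g \<in> G"
  then have "inj_on (\<lambda>h. g \<circ> h \<circ> inv_into UNIV g) H"
    using bij_betw_conjugation[OF bij[OF g]]
    by (auto simp: carrier_Aut bij_betw_def intro: inj_on_subset)
  then show "sum m H = sum m ((\<lambda>h. g \<circ> h \<circ> inv_into UNIV g) ` H)"
    using inv[OF g] by (simp add: sum.reindex)
qed

section \<open>Linear equivariant operators\<close>

lemma infnorm_rcomp_sum_le:
  fixes \<phi> :: "real ^ 'x::finite"
  shows "infnorm (\<Sum>h\<in>S. m h *\<^sub>R (\<phi> \<diamondop> k h)) \<le> (\<Sum>h\<in>S. \<bar>m h\<bar>) * infnorm \<phi>"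
proof -
  have "\<bar>(\<Sum>h\<in>S. m h *\<^sub>R (\<phi> \<diamondop> k h)) $ x\<bar> \<le> (\<Sum>h\<in>S. \<bar>m h\<bar>) * infnorm \<phi>" for x
  proof -
    have "\<bar>(\<Sum>h\<in>S. m h *\<^sub>R (\<phi> \<diamondop> k h)) $ x\<bar> \<le> (\<Sum>h\<in>S. \<bar>m h\<bar> * \<bar>\<phi> $ k h x\<bar>)"
      using sum_abs[of "\<lambda>h. m h * \<phi> $ k h x" S] by (simp add: rcomp_def abs_mult)
    also have "\<dots> \<le> (\<Sum>h\<in>S. \<bar>m h\<bar> * infnorm \<phi>)"
      by (intro sum_mono mult_left_mono component_le_infnorm_cart) simp
    finally show ?thesis by (simp add: sum_distrib_right)
  qed
  then show ?thesis by (simp add: infnorm_eq_Max)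
qed

lemma linear_eq_matrix_sum:
  fixes F :: "real ^ 'x::finite \<Rightarrow> real ^ 'y"
  assumes "linear F"
  shows "F \<phi> $ x = (\<Sum>y\<in>UNIV. F (axis y 1) $ x * \<phi> $ y)"
proof -
  have "F \<phi> = F (\<Sum>y\<in>UNIV. \<phi> $ y *\<^sub>R axis y 1)"
    by (simp add: basis_expansion flip: scalar_mult_eq_scaleR)
  also have "\<dots> = (\<Sum>y\<in>UNIV. \<phi> $ y *\<^sub>R F (axis y 1))"
    by (simp add: linear_sum[OF assms] linear_scale[OF assms])
  finally show ?thesis by (simp add: mult.commute)
qed

lemma geo_matrix_invariant:
  fixes F :: "real ^ 'x::finite \<Rightarrow> real ^ 'x"
  assumes "geo G F" and "g \<in> G" and "bij g"
  shows "F (axis (g y) 1) $ g x = F (axis y 1) $ x"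
proof -
  have "axis (g y) 1 \<diamondop> g = (axis y 1 :: real ^ 'x)"
    using \<open>bij g\<close> by (simp add: rcomp_def axis_def vec_eq_iff bij_is_inj inj_eq)
  then have "F (axis y 1) = F (axis (g y) 1) \<diamondop> g"
    using assms by (metis geo_def)
  then show ?thesis by (simp add: rcomp_def)
qed

theorem theorem1:
  fixes G :: "('x::finite \<Rightarrow> 'x) set"
    and F :: "real ^ 'x \<Rightarrow> real ^ 'x"
  assumes "subgroup G Aut"
    and "acts_transitively G"
    and "linear F"
    and "geo G F"
  shows "\<exists>\<mu>. permutant_measure G \<mu> \<and>
    (\<forall>\<phi>. F \<phi> = (\<Sum>h\<in>carrier Aut. \<mu> {h} *\<^sub>R (\<phi> \<diamondop> inv_into UNIV h))) \<and>
    is_maximum (\<Sum>h\<in>carrier Aut. \<bar>\<mu> {h}\<bar>) {infnorm (F \<phi>) / infnorm \<phi> | \<phi>. \<phi> \<noteq> 0}"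
proof -
  have bij: "bij g" if "g \<in> G" for g
    using subgroup.mem_carrier[OF assms(1) that] by (simp add: carrier_Aut)
  have ne: "G \<noteq> {}"
    using subgroup.one_closed[OF assms(1)] by blast
  have comp: "g \<circ> k \<in> G" if "g \<in> G" "k \<in> G" for g k
    using subgroup.m_closed[OF assms(1) that] that by (simp add: mult_Aut bij)
  have trans: "\<exists>g\<in>G. g x = y" for x y
    using assms(1,2) by (simp add: acts_transitively_iff)
  define B where "B x y = F (axis y 1) $ x" for x y
  have F: "F \<phi> $ x = (\<Sum>y\<in>UNIV. B x y * \<phi> $ y)" for \<phi> x
    unfolding B_def by (rule linear_eq_matrix_sum[OF assms(3)])
  have inv: "B (g x) (g y) = B x y" if "g \<in> G" for g x y
    unfolding B_def using geo_matrix_invariant[OF assms(4) that bij[OF that]] .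
  \<comment> \<open>coefficients of least total variation, not yet invariant under conjugation\<close>
  obtain c where c: "\<And>x y. B x y = (\<Sum>h | bij h. c h * of_bool (h y = x))"
      "\<And>x. (\<Sum>h | bij h. \<bar>c h\<bar>) \<le> (\<Sum>y\<in>UNIV. \<bar>B x y\<bar>)"
    using transitive_invariant_decomposition[of G B, OF bij trans inv] by blast
  have "\<exists>m. (\<forall>g\<in>G. \<forall>h. m (g \<circ> h \<circ> inv_into UNIV g) = m h)
      \<and> (\<forall>x y. B x y = (\<Sum>h | bij h. m h * of_bool (h y = x)))
      \<and> (\<Sum>h | bij h. \<bar>m h\<bar>) \<le> (\<Sum>h | bij h. \<bar>c h\<bar>)"
    by (rule average_over_conjugates[OF bij ne comp inv c(1)])
  then obtain m where m_inv: "\<And>g h. g \<in> G \<Longrightarrow> m (g \<circ> h \<circ> inv_into UNIV g) = m h"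
    and m_rep: "\<And>x y. B x y = (\<Sum>h | bij h. m h * of_bool (h y = x))"
    and m_le: "(\<Sum>h | bij h. \<bar>m h\<bar>) \<le> (\<Sum>h | bij h. \<bar>c h\<bar>)"
    by blast
  let ?s = "\<Sum>h | bij h. \<bar>m h\<bar>"
  have rep: "F \<phi> = (\<Sum>h | bij h. m h *\<^sub>R (\<phi> \<diamondop> inv_into UNIV h))" for \<phi>
  proof -
    have "F \<phi> $ x = (\<Sum>h | bij h. m h *\<^sub>R (\<phi> \<diamondop> inv_into UNIV h)) $ x" for x
    proof -
      have "F \<phi> $ x = (\<Sum>h | bij h. \<Sum>y\<in>UNIV. m h * of_bool (h y = x) * \<phi> $ y)"
        unfolding F m_rep sum_distrib_right by (rule sum.swap)
      also have "\<dots> = (\<Sum>h | bij h. m h * \<phi> $ inv_into UNIV h x)"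
      proof (intro sum.cong refl)
        fix h :: "'x \<Rightarrow> 'x"
        assume "h \<in> {h. bij h}"
        then have "h y = x \<longleftrightarrow> y = inv_into UNIV h x" for y
          by (simp add: bij_apply_eq_iff)
        then have "(\<Sum>y\<in>UNIV. m h * of_bool (h y = x) * \<phi> $ y)
            = (\<Sum>y\<in>UNIV. if y = inv_into UNIV h x then m h * \<phi> $ y else 0)"
          by (intro sum.cong) auto
        then show "(\<Sum>y\<in>UNIV. m h * of_bool (h y = x) * \<phi> $ y) = m h * \<phi> $ inv_into UNIV h x"
          by simp
      qed
      finally show ?thesis by (simp add: rcomp_def)
    qed
    then show ?thesis by (simp add: vec_eq_iff)
  qed
  have upper: "infnorm (F \<phi>) \<le> ?s * infnorm \<phi>" for \<phi>
    unfolding rep by (rule infnorm_rcomp_sum_le)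
  have "\<exists>\<phi>. \<phi> \<noteq> 0 \<and> ?s = infnorm (F \<phi>) / infnorm \<phi>"
  proof -
    fix x :: 'x
    \<comment> \<open>Zero entries of the row get the sign 1, so that \<open>\<phi>\<close> is nonzero even if the row vanishes.\<close>
    define \<phi> :: "real ^ 'x" where "\<phi> = (\<chi> y. if 0 \<le> B x y then 1 else - 1)"
    have "range (\<lambda>y. \<bar>\<phi> $ y\<bar>) = {1}"
      by (auto simp: \<phi>_def)
    then have norm: "infnorm \<phi> = 1"
      by (simp add: infnorm_eq_Max)
    have "?s \<le> (\<Sum>y\<in>UNIV. \<bar>B x y\<bar>)"
      using m_le c(2)[of x] by linarith
    also have "\<dots> = F \<phi> $ x"
      unfolding F by (intro sum.cong) (auto simp: \<phi>_def)
    also have "\<dots> \<le> infnorm (F \<phi>)"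
      using component_le_infnorm_cart[of "F \<phi>" x] by linarith
    finally have "?s = infnorm (F \<phi>)"
      using upper[of \<phi>] norm by simp
    moreover have "\<phi> \<noteq> 0"
      using norm by (auto simp: infnorm_0)
    ultimately show ?thesis using norm by auto
  qed
  moreover have "infnorm (F \<phi>) / infnorm \<phi> \<le> ?s" if "\<phi> \<noteq> 0" for \<phi>
    using upper[of \<phi>] that by (simp add: divide_le_eq infnorm_pos_lt)
  ultimately have "is_maximum ?s {infnorm (F \<phi>) / infnorm \<phi> | \<phi>. \<phi> \<noteq> 0}"
    unfolding is_maximum_def by blast
  moreover have "permutant_measure G (sum m)"
    using bij m_inv by (rule permutant_measure_sum)
  ultimately show ?thesis
    using rep by (intro exI[of _ "sum m"]) (simp add: carrier_Aut)
qed

end
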